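(* For every positive integer $m$, define $$\xi(m):= \sum_{k=0}^m \binom{m}{k} \left( \frac{k}{m} \right)^k \left( 1-\frac{k}{m} \right)^{m-k}$$ and $$\xi_2(m):= \sum_{j=0}^m \sum_{k=0}^{m-j} \binom{m}{j} \binom{m-j}{k} \left( \frac{j}{m} \right)^j \left( \frac{k}{m} \right)^k \left( 1-\frac{j}{m}-\frac{k}{m} \right)^{m-j-k}.$$ Then for every positive integer $m$, $$\xi(m) = \frac{1}{m^m} \sum_{j=0}^m m^j \frac{m!}{j!}, \qquad \xi_2(m) = \frac{1}{m^m}\sum_{j=0}^m m^{m-j} \binom{m}{j} (j+1)!,$$ and furthermore $$\xi_2(m) = \xi(m)+m.$$
   Context: Here $m$ ranges over the positive integers $\mathbb{N}=\{1,2,3,\dots\}$ (so that $k/m$ is defined), and the convention $0^0=1$ is used in the sums. *)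

theory Defs
  imports Complex_Main
begin

(* The power x ^ 0 equals 1 for every x, in particular 0 ^ 0 = 1. Both functions
   are of interest only for m > 0; at m = 0 they have junk values (x / 0 = 0). *)

definition xi :: "nat \<Rightarrow> real" where
  "xi m = (\<Sum>k=0..m. real (m choose k) * (real k / real m) ^ k
             * (1 - real k / real m) ^ (m - k))"

definition xi2 :: "nat \<Rightarrow> real" where
  "xi2 m = (\<Sum>j=0..m. \<Sum>k=0..m - j. real (m choose j) * real ((m - j) choose k)
              * (real j / real m) ^ j * (real k / real m) ^ k
              * (1 - real j / real m - real k / real m) ^ (m - j - k))"

end

theory Submission
  imports Defs
begin

text \<open>
  Everything rests on Cauchy's relative of Abel's binomial theorem,
  \[ \sum_k \binom{n}{k} (x+k)^k (y+n-k)^{n-k} = \sum_j \binom{n}{j} j!\, (x+y+n)^{n-j}. \]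
  Writing $y+n-k = (x+y+n) - (x+k)$ and expanding, the coefficient of $(x+y+n)^{n-j}$ is
  $\binom{n}{j}$ times the $j$-th finite difference of $t^j$ at $x$, which is $j!$.
  The value of $\xi$ is the case $x = y = 0$. For $\xi_2$ the identity is applied to the inner sum,
  and, after the order of summation is exchanged, once more with $x = 0$ and $y = i$.
  The difference of the two closed forms telescopes to $m$.
\<close>

section \<open>Rearranging triangular sums and products of binomials\<close>

lemma sum_triangle_diagonal:
  fixes g :: "nat \<Rightarrow> nat \<Rightarrow> 'a::comm_monoid_add"
  shows "(\<Sum>k\<le>n. \<Sum>i\<le>n - k. g k i) = (\<Sum>j\<le>n. \<Sum>k\<le>j. g k (j - k))"
proof -
  have "(\<Sum>k\<le>n. \<Sum>i\<le>n - k. g k i) = sum (\<lambda>(k, i). g k i) (SIGMA k:{..n}. {..n - k})"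
    by (simp add: sum.Sigma)
  also have "(SIGMA k:{..n}. {..n - k}) = {(k, i). k + i \<le> n}"
    by auto
  finally show ?thesis
    by (simp add: sum.triangle_reindex_eq)
qed

lemma sum_triangle_swap:
  fixes g :: "nat \<Rightarrow> nat \<Rightarrow> 'a::comm_monoid_add"
  shows "(\<Sum>k\<le>n. \<Sum>i\<le>n - k. g k i) = (\<Sum>i\<le>n. \<Sum>k\<le>n - i. g k i)"
proof -
  have "(\<Sum>k\<le>n. \<Sum>i\<le>n - k. g k i) = (\<Sum>k\<le>n. \<Sum>i | i \<in> {..n} \<and> k + i \<le> n. g k i)"
    by (intro sum.cong) auto
  also have "\<dots> = (\<Sum>i\<le>n. \<Sum>k | k \<in> {..n} \<and> k + i \<le> n. g k i)"
    by (rule sum.swap_restrict) auto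
  also have "\<dots> = (\<Sum>i\<le>n. \<Sum>k\<le>n - i. g k i)"
    by (intro sum.cong) auto
  finally show ?thesis .
qed

text \<open>Both products count ordered pairs of disjoint subsets of sizes \<open>j\<close> and
  \<open>i\<close>: choose the union first, then split it.\<close>

lemma choose_mult_commute:
  assumes "j + i \<le> n"
  shows "(n choose j) * ((n - j) choose i) = (n choose i) * ((n - i) choose j)"
proof -
  have "(n choose (j + i)) * ((j + i) choose j) = (n choose j) * ((n - j) choose i)"
    using choose_mult[of j "j + i" n] assms by simp
  moreover have "(n choose (j + i)) * ((j + i) choose i) = (n choose i) * ((n - i) choose j)"
    using choose_mult[of i "j + i" n] assms by simp
  moreover have "(j + i) choose j = (j + i) choose i"
    using binomial_symmetric[of j "j + i"] by simp
  ultimately show ?thesis by simp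
qed

section \<open>Finite differences of powers\<close>

text \<open>One factor \<open>x + of_nat k\<close> is split off. Its \<open>k\<close> is absorbed by
  \<open>k * (Suc j choose k) = Suc j * (j choose (k - 1))\<close>, and the index shift moves
  \<open>x\<close> to \<open>x + 1\<close>.\<close>

lemma finite_difference_Suc:
  fixes x :: "'a::comm_ring_1"
  shows "(\<Sum>k\<le>Suc j. of_nat (Suc j choose k) * (-1) ^ (Suc j - k) * (x + of_nat k) ^ Suc p)
    = x * (\<Sum>k\<le>Suc j. of_nat (Suc j choose k) * (-1) ^ (Suc j - k) * (x + of_nat k) ^ p)
      + of_nat (Suc j) * (\<Sum>k\<le>j. of_nat (j choose k) * (-1) ^ (j - k) * (x + 1 + of_nat k) ^ p)"
proof -
  let ?D = "\<lambda>k. (-1) ^ (Suc j - k) * (x + of_nat k) ^ p :: 'a"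
  have "(\<Sum>k\<le>Suc j. of_nat (Suc j choose k) * (-1) ^ (Suc j - k) * (x + of_nat k) ^ Suc p)
    = x * (\<Sum>k\<le>Suc j. of_nat (Suc j choose k) * ?D k)
      + (\<Sum>k\<le>Suc j. of_nat (k * (Suc j choose k)) * ?D k)"
    by (simp only: sum_distrib_left sum.distrib[symmetric]) (simp add: algebra_simps)
  also have "(\<Sum>k\<le>Suc j. of_nat (k * (Suc j choose k)) * ?D k)
    = (\<Sum>k\<le>j. of_nat (Suc k * (Suc j choose Suc k)) * ?D (Suc k))"
    by (subst sum.atMost_Suc_shift) simp
  also have "\<dots> = of_nat (Suc j) * (\<Sum>k\<le>j. of_nat (j choose k) * ?D (Suc k))"
    by (simp only: Suc_times_binomial of_nat_mult sum_distrib_left mult.assoc)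
  finally show ?thesis
    by (simp add: mult.assoc add.assoc)
qed

text \<open>The sum is the \<open>j\<close>-th forward difference of \<open>t ^ p\<close> at
  \<open>x\<close>. The recursion lowers \<open>j\<close> and shifts \<open>x\<close>, so the
  induction on \<open>p\<close> leaves both arbitrary.\<close>

lemma finite_difference_power:
  fixes x :: "'a::{comm_ring_1,ring_char_0}"
  assumes "p \<le> j"
  shows "(\<Sum>k\<le>j. of_nat (j choose k) * (-1) ^ (j - k) * (x + of_nat k) ^ p)
    = (if p = j then fact j else 0)"
  using assms
proof (induction p arbitrary: j x)
  case 0
  \<comment> \<open>For \<open>p = 0\<close> the sum is \<open>(1 + (-1)) ^ j\<close>, which is 1
    only at \<open>j = 0\<close>.\<close>
  show ?case
    using binomial_ring[of "1::'a" "-1" j] by (cases "j = 0") (simp_all add: power_0_left)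
next
  case (Suc p)
  then obtain i where i: "j = Suc i" "p \<le> i"
    by (cases j) auto
  \<comment> \<open>Since \<open>p < Suc i\<close>, the first sum of the recursion vanishes; the
    second gives \<open>Suc i * fact i\<close> when \<open>p = i\<close> and 0 otherwise.\<close>
  show ?case
    unfolding i finite_difference_Suc using Suc.IH[of i "x + 1"] Suc.IH[of "Suc i" x] i
    by simp
qed

section \<open>Cauchy's identity and its iteration\<close>

lemma Cauchy_Abel_identity:
  fixes x y :: "'a::{comm_ring_1,ring_char_0}"
  shows "(\<Sum>k\<le>n. of_nat (n choose k) * (x + of_nat k) ^ k * (y + of_nat (n - k)) ^ (n - k))
    = (\<Sum>j\<le>n. of_nat (n choose j) * fact j * (x + y + of_nat n) ^ (n - j))"
proof -
  define s where "s = x + y + of_nat n"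
  have "of_nat (n choose k) * (x + of_nat k) ^ k * (y + of_nat (n - k)) ^ (n - k)
    = (\<Sum>i\<le>n - k. of_nat ((n choose k) * ((n - k) choose i)) * (-1) ^ i
          * (x + of_nat k) ^ (k + i) * s ^ (n - (k + i)))" if "k \<le> n" for k
  proof -
    have "y + of_nat (n - k) = - (x + of_nat k) + s"
      using that by (simp add: s_def of_nat_diff)
    then have "(y + of_nat (n - k)) ^ (n - k)
      = (\<Sum>i\<le>n - k. of_nat ((n - k) choose i) * ((-1) ^ i * (x + of_nat k) ^ i) * s ^ (n - k - i))"
      by (simp only: binomial_ring power_minus[of "x + of_nat k"])
    then show ?thesis
      by (simp add: sum_distrib_left power_add mult_ac)
  qed
  then have "(\<Sum>k\<le>n. of_nat (n choose k) * (x + of_nat k) ^ k * (y + of_nat (n - k)) ^ (n - k))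
    = (\<Sum>k\<le>n. \<Sum>i\<le>n - k. of_nat ((n choose k) * ((n - k) choose i)) * (-1) ^ i
          * (x + of_nat k) ^ (k + i) * s ^ (n - (k + i)))"
    by simp
  \<comment> \<open>Terms are grouped by \<open>j = k + i\<close>, the total exponent of
    \<open>x + of_nat k\<close>.\<close>
  also have "\<dots> = (\<Sum>j\<le>n. \<Sum>k\<le>j. of_nat ((n choose k) * ((n - k) choose (j - k))) * (-1) ^ (j - k)
          * (x + of_nat k) ^ (k + (j - k)) * s ^ (n - (k + (j - k))))"
    by (rule sum_triangle_diagonal)
  \<comment> \<open>Rewriting the binomials as \<open>(n choose j) * (j choose k)\<close> isolates
    the \<open>j\<close>-th difference of \<open>t ^ j\<close>.\<close>
  also have "\<dots> = (\<Sum>j\<le>n. of_nat (n choose j)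
      * (\<Sum>k\<le>j. of_nat (j choose k) * (-1) ^ (j - k) * (x + of_nat k) ^ j) * s ^ (n - j))"
    unfolding sum_distrib_left sum_distrib_right
    by (intro sum.cong refl) (simp add: choose_mult[symmetric] mult_ac)
  also have "\<dots> = (\<Sum>j\<le>n. of_nat (n choose j) * fact j * s ^ (n - j))"
    by (simp add: finite_difference_power)
  finally show ?thesis
    by (simp add: s_def)
qed

lemma Cauchy_Abel_identity_zero:
  "(\<Sum>k\<le>n. of_nat (n choose k) * of_nat k ^ k * of_nat (n - k) ^ (n - k))
    = (\<Sum>j\<le>n. of_nat (n choose j) * fact j * of_nat n ^ (n - j) :: 'a::{comm_ring_1,ring_char_0})"
  using Cauchy_Abel_identity[of n "0::'a" 0] by simp

lemma choose_mult_choose_fact: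
  assumes "i \<le> s" "s \<le> m"
  shows "(m choose i) * fact i * (((m - i) choose (s - i)) * fact (s - i)) = (m choose s) * (fact s :: nat)"
proof -
  have "(m choose i) * ((m - i) choose (s - i)) = (m choose s) * (s choose i)"
    using choose_mult[OF assms] by simp
  then show ?thesis
    using binomial_fact_lemma[OF assms(1)] by (metis mult.assoc mult.commute)
qed

lemma double_Cauchy_Abel_identity_zero:
  "(\<Sum>j\<le>m. \<Sum>k\<le>m - j. of_nat (m choose j) * of_nat ((m - j) choose k) * of_nat j ^ j * of_nat k ^ k
        * of_nat (m - j - k) ^ (m - j - k))
    = (\<Sum>s\<le>m. of_nat (m choose s) * fact (Suc s) * of_nat m ^ (m - s) :: 'a::{comm_ring_1,ring_char_0})"
    (is "?L = _")
proof -
  have "?L = (\<Sum>j\<le>m. of_nat (m choose j) * of_nat j ^ j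
      * (\<Sum>k\<le>m - j. of_nat ((m - j) choose k) * of_nat k ^ k * of_nat (m - j - k) ^ (m - j - k)))"
    by (simp add: sum_distrib_left mult_ac)
  also have "\<dots> = (\<Sum>j\<le>m. \<Sum>i\<le>m - j. of_nat ((m choose j) * ((m - j) choose i)) * fact i
      * of_nat j ^ j * of_nat (m - j) ^ (m - j - i))"
    unfolding Cauchy_Abel_identity_zero sum_distrib_left
    by (simp only: of_nat_mult mult_ac)
  also have "\<dots> = (\<Sum>i\<le>m. \<Sum>j\<le>m - i. of_nat ((m choose j) * ((m - j) choose i)) * fact i
      * of_nat j ^ j * of_nat (m - j) ^ (m - j - i))"
    by (rule sum_triangle_swap)
  \<comment> \<open>The base \<open>m - j\<close> is written as \<open>i + (m - i - j)\<close>, and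
    \<open>0 +\<close> is inserted, to match the identity with \<open>n = m - i\<close>.\<close>
  also have "\<dots> = (\<Sum>i\<le>m. of_nat (m choose i) * fact i * (\<Sum>j\<le>m - i. of_nat ((m - i) choose j)
      * (0 + of_nat j) ^ j * (of_nat i + of_nat (m - i - j)) ^ (m - i - j)))"
    unfolding sum_distrib_left
  proof (intro sum.cong refl)
    fix i j assume "i \<in> {..m}" "j \<in> {..m - i}"
    then have le: "j + i \<le> m" by auto
    have "of_nat i + of_nat (m - i - j) = (of_nat (m - j) :: 'a)"
      using le by (metis of_nat_add add.commute diff_commute le_add_diff_inverse le_diff_conv2 add_leD1)
    moreover have "m - j - i = m - i - j" by simp
    ultimately show "of_nat ((m choose j) * ((m - j) choose i)) * fact i
        * of_nat j ^ j * of_nat (m - j) ^ (m - j - i)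
      = of_nat (m choose i) * fact i * (of_nat ((m - i) choose j)
        * (0 + of_nat j) ^ j * (of_nat i + of_nat (m - i - j)) ^ (m - i - j) :: 'a)"
      unfolding choose_mult_commute[OF le] by (simp add: mult_ac)
  qed
  \<comment> \<open>Here \<open>x + y + n\<close> is \<open>0 + i + (m - i) = m\<close>, so the base
    no longer depends on \<open>i\<close>.\<close>
  also have "\<dots> = (\<Sum>i\<le>m. \<Sum>l\<le>m - i. of_nat ((m choose i) * fact i * (((m - i) choose l) * fact l))
      * of_nat m ^ (m - (i + l)))"
    unfolding Cauchy_Abel_identity sum_distrib_left
    by (intro sum.cong refl) (simp add: mult_ac flip: of_nat_add)
  also have "\<dots> = (\<Sum>s\<le>m. \<Sum>i\<le>s. of_nat ((m choose i) * fact i * (((m - i) choose (s - i)) * fact (s - i)))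
      * of_nat m ^ (m - (i + (s - i))))"
    by (rule sum_triangle_diagonal)
  \<comment> \<open>The summand is now free of \<open>i\<close>; its \<open>s + 1\<close> copies
    turn \<open>fact s\<close> into \<open>fact (Suc s)\<close>.\<close>
  also have "\<dots> = (\<Sum>s\<le>m. \<Sum>i\<le>s. of_nat ((m choose s) * fact s) * of_nat m ^ (m - s))"
    by (intro sum.cong refl) (simp only: choose_mult_choose_fact atMost_iff le_add_diff_inverse)
  also have "\<dots> = (\<Sum>s\<le>m. of_nat (m choose s) * fact (Suc s) * of_nat m ^ (m - s))"
    by (simp add: mult_ac algebra_simps)
  finally show ?thesis .
qed

section \<open>Evaluation of \<open>xi\<close> and \<open>xi2\<close>\<close>

text \<open>The sum telescopes: for \<open>t > 0\<close> the term is
  \<open>x ^ Suc t / fact t - x ^ t / fact (t - 1)\<close>.\<close>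

lemma sum_diff_mult_power_div_fact:
  fixes x :: "'a::field_char_0"
  shows "(\<Sum>t\<le>n. (x - of_nat t) * x ^ t / fact t) = x ^ Suc n / fact n"
proof (induction n)
  case (Suc n)
  have "x ^ Suc n / fact n = of_nat (Suc n) * x ^ Suc n / (fact (Suc n) :: 'a)"
    by (simp add: divide_simps del: of_nat_Suc)
  with Suc show ?case
    by (simp add: diff_divide_distrib add_divide_distrib algebra_simps)
qed simp

lemma xi_eq_sum_choose:
  assumes "m > 0"
  shows "xi m = 1 / real m ^ m * (\<Sum>j\<le>m. real (m choose j) * fact j * real m ^ (m - j))"
proof -
  \<comment> \<open>The exponents add up to \<open>m\<close>, so the denominators combine to
    \<open>real m ^ m\<close>.\<close>
  have "(real k / real m) ^ k * (1 - real k / real m) ^ (m - k)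
    = 1 / real m ^ m * (real k ^ k * real (m - k) ^ (m - k))" if "k \<le> m" for k
  proof -
    have "1 - real k / real m = real (m - k) / real m"
      using assms that by (simp add: field_simps of_nat_diff)
    moreover have "real m ^ m = real m ^ k * real m ^ (m - k)"
      using that by (simp flip: power_add)
    ultimately show ?thesis
      by (simp add: power_divide)
  qed
  then have "xi m = 1 / real m ^ m
      * (\<Sum>k\<le>m. real (m choose k) * real k ^ k * real (m - k) ^ (m - k))"
    unfolding xi_def atLeast0AtMost sum_distrib_left
    by (intro sum.cong refl) (simp add: mult.assoc)
  then show ?thesis
    by (simp only: Cauchy_Abel_identity_zero)
qed

lemma xi2_eq_sum_choose:
  assumes "m > 0"
  shows "xi2 m = 1 / real m ^ m * (\<Sum>j\<le>m. real (m choose j) * fact (Suc j) * real m ^ (m - j))"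
proof -
  have "(real j / real m) ^ j * ((real k / real m) ^ k
      * (1 - real j / real m - real k / real m) ^ (m - j - k))
    = 1 / real m ^ m * (real j ^ j * (real k ^ k * real (m - j - k) ^ (m - j - k)))"
    if "j \<le> m" "k \<le> m - j" for j k
  proof -
    have "1 - real j / real m - real k / real m = real (m - j - k) / real m"
      using assms that by (simp add: field_simps of_nat_diff)
    moreover have "real m ^ m = real m ^ j * (real m ^ k * real m ^ (m - j - k))"
      using that by (simp flip: power_add)
    ultimately show ?thesis
      by (simp add: power_divide)
  qed
  then have "xi2 m = 1 / real m ^ m * (\<Sum>j\<le>m. \<Sum>k\<le>m - j. real (m choose j)
      * real ((m - j) choose k) * real j ^ j * real k ^ k * real (m - j - k) ^ (m - j - k))"
    unfolding xi2_def atLeast0AtMost sum_distrib_left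
    by (intro sum.cong refl) (simp add: mult.assoc)
  then show ?thesis
    by (simp only: double_Cauchy_Abel_identity_zero)
qed

text \<open>Put \<open>t = m - j\<close> in
  \<open>(m choose j) * fact j = fact m / fact (m - j)\<close>. The weight \<open>h\<close> is
  arbitrary to serve both the formula for \<open>xi\<close> and the difference
  \<open>xi2 m - xi m\<close>.\<close>

lemma sum_choose_fact_reverse:
  fixes h :: "nat \<Rightarrow> real"
  shows "(\<Sum>j\<le>m. real (m choose j) * fact j * h j) = (\<Sum>t\<le>m. h (m - t) * (fact m / fact t))"
proof -
  have "(\<Sum>j\<le>m. real (m choose j) * fact j * h j) = (\<Sum>j\<le>m. h j * (fact m / fact (m - j)))"
    by (intro sum.cong refl) (simp add: binomial_fact)
  also have "\<dots> = (\<Sum>t\<le>m. h (m - t) * (fact m / fact t))"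
    by (rule sum.reindex_bij_witness[of _ "\<lambda>t. m - t" "\<lambda>t. m - t"]) auto
  finally show ?thesis .
qed

theorem mainTheorem1:
  fixes m :: nat
  assumes "m > 0"
  shows "xi m = 1 / real m ^ m * (\<Sum>j=0..m. real m ^ j * (fact m / fact j))
       \<and> xi2 m = 1 / real m ^ m * (\<Sum>j=0..m. real m ^ (m - j) * real (m choose j) * fact (j + 1))
       \<and> xi2 m = xi m + real m"
proof (intro conjI)
  show "xi m = 1 / real m ^ m * (\<Sum>j=0..m. real m ^ j * (fact m / fact j))"
    by (simp add: xi_eq_sum_choose[OF assms] sum_choose_fact_reverse atLeast0AtMost)
  show "xi2 m = 1 / real m ^ m * (\<Sum>j=0..m. real m ^ (m - j) * real (m choose j) * fact (j + 1))"
    by (simp add: xi2_eq_sum_choose[OF assms] atLeast0AtMost mult_ac)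
  \<comment> \<open>The weight \<open>j\<close> comes from
    \<open>fact (Suc j) - fact j = j * fact j\<close>; reversal turns it into \<open>m - t\<close>,
    the telescoping form with \<open>x = m\<close>.\<close>
  have "(\<Sum>j\<le>m. real (m choose j) * fact (Suc j) * real m ^ (m - j))
      - (\<Sum>j\<le>m. real (m choose j) * fact j * real m ^ (m - j))
    = (\<Sum>j\<le>m. real (m choose j) * fact j * (real j * real m ^ (m - j)))"
    unfolding sum_subtractf[symmetric] by (intro sum.cong refl) (simp add: algebra_simps)
  also have "\<dots> = fact m * (\<Sum>t\<le>m. (real m - real t) * real m ^ t / fact t)"
    unfolding sum_choose_fact_reverse sum_distrib_left
    by (intro sum.cong refl) (simp add: of_nat_diff)
  also have "\<dots> = real m * real m ^ m"
    by (simp add: sum_diff_mult_power_div_fact)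
  finally show "xi2 m = xi m + real m"
    unfolding xi_eq_sum_choose[OF assms] xi2_eq_sum_choose[OF assms]
    using assms by (simp add: field_simps)
qed

end
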